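(* Let $\beta(t)=\varphi_{(\alpha,q_o)}(s(t),u(t))$ be a unit speed curve on the OT-ruled surface $\varphi_{(\alpha,q_o)}$ with unit tangent $\vec v_p=C\frac{\partial\vec\varphi_{(\alpha,q_o)}}{\partial s}+D\frac{\partial\vec\varphi_{(\alpha,q_o)}}{\partial u}$, where $C=\dot s$ and $D=\dot u$. Then $\beta$ is an asymptotic curve if and only if $\beta(t)$ is a ruling or $$(C\cos\theta+D)(A_1\cos\theta+A_2)+(CA_1+DB_1)(f^2+g^2)=0$$ holds.
   Context: Let $\alpha:I\to\mathbb{R}^3$ ($I\subset\mathbb{R}$ an open interval) be a smooth curve with arc-length parameter $s$, curvature $\kappa$, torsion $\tau$ and Frenet frame $\{\vec T,\vec N,\vec B\}$, so $\vec T'=\kappa\vec N$, $\vec N'=-\kappa\vec T+\tau\vec B$, $\vec B'=-\tau\vec N$. Let $\theta:I\to\mathbb{R}$ be a $C^\infty$ function and $\vec q_o=\cos\theta\,\vec T+\sin\theta\,\vec N$. The osculating-type (OT)-ruled surface of $\alpha$ is $\vec\varphi_{(\alpha,q_o)}(s,u)=\vec\alpha(s)+u\,\vec q_o(s)$, $(s,u)\in I\times\mathbb{R}$; its rulings are the lines $s=$ constant. Put $\eta=\theta'+\kappa$, $\mu=\tau\sin\theta$, $\xi=\tau\cos\theta$, $f=\sin\theta-u\eta$, $g=u\mu$, $\vec r=\sin\theta\,\vec T-\cos\theta\,\vec N$; subscript $s$ denotes $\partial/\partial s$, and $g^2(f/g)_s$ stands for $gf_s-fg_s$. At regular points the unit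 normal is $\vec U=\frac{1}{\sqrt{f^2+g^2}}(f\vec B-g\vec r)$ and the Weingarten map $S_p(\vec v)=-D_{\vec v}\vec U$ satisfies $S_p(\partial_s\vec\varphi)=A_1\partial_s\vec\varphi+A_2\partial_u\vec\varphi$, $S_p(\partial_u\vec\varphi)=B_1\partial_s\vec\varphi+B_2\partial_u\vec\varphi$, where $$A_1=\frac{-1}{(f^2+g^2)^{3/2}}\left[g^2\left(\tfrac{f}{g}\right)_s+(f^2+g^2)\xi\right],$$ $$A_2=\frac{1}{(f^2+g^2)^{3/2}}\left[(f^2+g^2)(f\mu+g\eta+\xi\cos\theta)+g^2\cos\theta\left(\tfrac{f}{g}\right)_s\right],$$ $$B_1=\frac{\mu\sin\theta}{(f^2+g^2)^{3/2}},\qquad B_2=\frac{-\mu\cos\theta\sin\theta}{(f^2+g^2)^{3/2}}.$$ Here $t$ is the arc-length parameter of $\beta$ and a dot denotes $d/dt$; all quantities in the claim are evaluated at $(s(t),u(t))$. The curve $\beta$ is asymptotic if its normal curvature $k_n(\vec v_p)=\langle S_p(\vec v_p),\vec v_p\rangle$ vanishes along it. *)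

theory Defs
  imports "HOL-Analysis.Analysis"
begin

type_synonym R3 = "real ^ 3"

abbreviation vderiv :: "(real \<Rightarrow> 'a::real_normed_vector) \<Rightarrow> real \<Rightarrow> 'a" where
  "vderiv f t \<equiv> vector_derivative f (at t)"

(* C-infinity on an open set A: every iterated derivative exists at every point of A. *)
definition smooth_on :: "(real \<Rightarrow> 'a::real_normed_vector) \<Rightarrow> real set \<Rightarrow> bool" where
  "smooth_on f A \<longleftrightarrow> (\<forall>n. \<forall>x\<in>A. ((\<lambda>g. vderiv g) ^^ n) f differentiable (at x))"

definition open_interval :: "real set \<Rightarrow> bool" where
  "open_interval A \<longleftrightarrow> open A \<and> is_interval A"

definition unit_speed_on :: "(real \<Rightarrow> R3) \<Rightarrow> real set \<Rightarrow> bool" where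
  "unit_speed_on c A \<longleftrightarrow> (\<forall>t\<in>A. norm (vderiv c t) = 1)"


definition frenet_T :: "(real \<Rightarrow> R3) \<Rightarrow> real \<Rightarrow> R3" where
  "frenet_T \<alpha> s = vderiv \<alpha> s"

definition curvature :: "(real \<Rightarrow> R3) \<Rightarrow> real \<Rightarrow> real" where
  "curvature \<alpha> s = norm (vderiv (frenet_T \<alpha>) s)"

definition frenet_N :: "(real \<Rightarrow> R3) \<Rightarrow> real \<Rightarrow> R3" where
  "frenet_N \<alpha> s = vderiv (frenet_T \<alpha>) s /\<^sub>R curvature \<alpha> s"

definition frenet_B :: "(real \<Rightarrow> R3) \<Rightarrow> real \<Rightarrow> R3" where
  "frenet_B \<alpha> s = cross3 (frenet_T \<alpha> s) (frenet_N \<alpha> s)"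

(* Sign convention: B' = - torsion * N. *)
definition torsion :: "(real \<Rightarrow> R3) \<Rightarrow> real \<Rightarrow> real" where
  "torsion \<alpha> s = - (vderiv (frenet_B \<alpha>) s \<bullet> frenet_N \<alpha> s)"

(* The curvature must not vanish for the Frenet frame to be defined. *)
definition frenet_curve :: "(real \<Rightarrow> R3) \<Rightarrow> real set \<Rightarrow> bool" where
  "frenet_curve \<alpha> I \<longleftrightarrow>
     smooth_on \<alpha> I \<and> unit_speed_on \<alpha> I \<and> (\<forall>s\<in>I. curvature \<alpha> s \<noteq> 0)"


(* A parametrized surface is a map X of the parameter plane; a point of the surface is
   represented by its parameter p, a curve on the surface by its parameter curve c, so that
   the curve in space is X o c. *)

definition tangent_map :: "(real \<times> real \<Rightarrow> R3) \<Rightarrow> real \<times> real \<Rightarrow> real \<times> real \<Rightarrow> R3" where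
  "tangent_map X p = frechet_derivative X (at p)"

definition normal_vec :: "(real \<times> real \<Rightarrow> R3) \<Rightarrow> real \<times> real \<Rightarrow> R3" where
  "normal_vec X p = cross3 (tangent_map X p (1, 0)) (tangent_map X p (0, 1))"

definition regular_point :: "(real \<times> real \<Rightarrow> R3) \<Rightarrow> real \<times> real \<Rightarrow> bool" where
  "regular_point X p \<longleftrightarrow> normal_vec X p \<noteq> 0"

definition unit_normal :: "(real \<times> real \<Rightarrow> R3) \<Rightarrow> real \<times> real \<Rightarrow> R3" where
  "unit_normal X p = normal_vec X p /\<^sub>R norm (normal_vec X p)"

(* S_p(v) = - D_v U.  At a regular point the tangent map is injective, so a tangent vector v
   has exactly one coordinate representation w, and D_v U is the derivative of U along w. *)
definition weingarten :: "(real \<times> real \<Rightarrow> R3) \<Rightarrow> real \<times> real \<Rightarrow> R3 \<Rightarrow> R3" where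
  "weingarten X p v =
     - frechet_derivative (unit_normal X) (at p) (THE w. tangent_map X p w = v)"

definition normal_curvature :: "(real \<times> real \<Rightarrow> R3) \<Rightarrow> real \<times> real \<Rightarrow> R3 \<Rightarrow> real" where
  "normal_curvature X p v = weingarten X p v \<bullet> v"

definition asymptotic_curve ::
  "(real \<times> real \<Rightarrow> R3) \<Rightarrow> (real \<Rightarrow> real \<times> real) \<Rightarrow> real set \<Rightarrow> bool" where
  "asymptotic_curve X c J \<longleftrightarrow>
     (\<forall>t\<in>J. normal_curvature X (c t) (vderiv (X \<circ> c) t) = 0)"

(* The rulings are the parameter lines on which the first coordinate is constant. *)
definition is_ruling :: "(real \<Rightarrow> real \<times> real) \<Rightarrow> real set \<Rightarrow> bool" where
  "is_ruling c J \<longleftrightarrow> (\<exists>s\<^sub>0. \<forall>t\<in>J. fst (c t) = s\<^sub>0)"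


definition OT_direction :: "(real \<Rightarrow> R3) \<Rightarrow> (real \<Rightarrow> real) \<Rightarrow> real \<Rightarrow> R3" where
  "OT_direction \<alpha> \<theta> s = cos (\<theta> s) *\<^sub>R frenet_T \<alpha> s + sin (\<theta> s) *\<^sub>R frenet_N \<alpha> s"

definition OT_surface :: "(real \<Rightarrow> R3) \<Rightarrow> (real \<Rightarrow> real) \<Rightarrow> real \<times> real \<Rightarrow> R3" where
  "OT_surface \<alpha> \<theta> = (\<lambda>(s, u). \<alpha> s + u *\<^sub>R OT_direction \<alpha> \<theta> s)"

definition OT_eta :: "(real \<Rightarrow> R3) \<Rightarrow> (real \<Rightarrow> real) \<Rightarrow> real \<Rightarrow> real" where
  "OT_eta \<alpha> \<theta> s = deriv \<theta> s + curvature \<alpha> s"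

definition OT_mu :: "(real \<Rightarrow> R3) \<Rightarrow> (real \<Rightarrow> real) \<Rightarrow> real \<Rightarrow> real" where
  "OT_mu \<alpha> \<theta> s = torsion \<alpha> s * sin (\<theta> s)"

definition OT_xi :: "(real \<Rightarrow> R3) \<Rightarrow> (real \<Rightarrow> real) \<Rightarrow> real \<Rightarrow> real" where
  "OT_xi \<alpha> \<theta> s = torsion \<alpha> s * cos (\<theta> s)"

definition OT_f :: "(real \<Rightarrow> R3) \<Rightarrow> (real \<Rightarrow> real) \<Rightarrow> real \<Rightarrow> real \<Rightarrow> real" where
  "OT_f \<alpha> \<theta> s u = sin (\<theta> s) - u * OT_eta \<alpha> \<theta> s"

definition OT_g :: "(real \<Rightarrow> R3) \<Rightarrow> (real \<Rightarrow> real) \<Rightarrow> real \<Rightarrow> real \<Rightarrow> real" where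
  "OT_g \<alpha> \<theta> s u = u * OT_mu \<alpha> \<theta> s"

(* g f_s - f g_s, written g^2 (f/g)_s in the formulas for A1 and A2; it is meaningful also
   where g vanishes. *)
definition OT_W :: "(real \<Rightarrow> R3) \<Rightarrow> (real \<Rightarrow> real) \<Rightarrow> real \<Rightarrow> real \<Rightarrow> real" where
  "OT_W \<alpha> \<theta> s u =
     OT_g \<alpha> \<theta> s u * deriv (\<lambda>x. OT_f \<alpha> \<theta> x u) s
     - OT_f \<alpha> \<theta> s u * deriv (\<lambda>x. OT_g \<alpha> \<theta> x u) s"

definition OT_Q :: "(real \<Rightarrow> R3) \<Rightarrow> (real \<Rightarrow> real) \<Rightarrow> real \<Rightarrow> real \<Rightarrow> real" where
  "OT_Q \<alpha> \<theta> s u = (OT_f \<alpha> \<theta> s u)\<^sup>2 + (OT_g \<alpha> \<theta> s u)\<^sup>2"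

(* A1, A2, B1: coefficients of the Weingarten map in the basis of coordinate vectors,
   S(X_s) = A1 X_s + A2 X_u and S(X_u) = B1 X_s + B2 X_u. *)

definition OT_A1 :: "(real \<Rightarrow> R3) \<Rightarrow> (real \<Rightarrow> real) \<Rightarrow> real \<Rightarrow> real \<Rightarrow> real" where
  "OT_A1 \<alpha> \<theta> s u =
     (- 1) / OT_Q \<alpha> \<theta> s u powr (3 / 2)
     * (OT_W \<alpha> \<theta> s u + OT_Q \<alpha> \<theta> s u * OT_xi \<alpha> \<theta> s)"

definition OT_A2 :: "(real \<Rightarrow> R3) \<Rightarrow> (real \<Rightarrow> real) \<Rightarrow> real \<Rightarrow> real \<Rightarrow> real" where
  "OT_A2 \<alpha> \<theta> s u =
     1 / OT_Q \<alpha> \<theta> s u powr (3 / 2)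
     * (OT_Q \<alpha> \<theta> s u
          * (OT_f \<alpha> \<theta> s u * OT_mu \<alpha> \<theta> s + OT_g \<alpha> \<theta> s u * OT_eta \<alpha> \<theta> s
             + OT_xi \<alpha> \<theta> s * cos (\<theta> s))
        + cos (\<theta> s) * OT_W \<alpha> \<theta> s u)"

definition OT_B1 :: "(real \<Rightarrow> R3) \<Rightarrow> (real \<Rightarrow> real) \<Rightarrow> real \<Rightarrow> real \<Rightarrow> real" where
  "OT_B1 \<alpha> \<theta> s u = OT_mu \<alpha> \<theta> s * sin (\<theta> s) / OT_Q \<alpha> \<theta> s u powr (3 / 2)"

end

theory Submission
  imports Defs
begin

text \<open>
  Write \<open>X\<close> for the surface and \<open>Q = f\<^sup>2 + g\<^sup>2\<close>. In the orthonormal frame \<open>(q, r, B)\<close> the coordinate vectors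
  are \<open>X\<^sub>s = cos \<theta> q + f r + g B\<close> and \<open>X\<^sub>u = q\<close>, so \<open>f B - g r\<close> is a normal field of length \<open>sqrt Q\<close>.
  The surface is ruled, so its second fundamental form has no \<open>du\<^sup>2\<close> term, and the normal curvature
  of the velocity \<open>C X\<^sub>s + D X\<^sub>u\<close> is \<open>C\<close> times a linear form in \<open>(C, D)\<close> (\<open>normal_curvature_OT\<close>). The
  left-hand side of the equation in the theorem is that linear form (\<open>equation_eq\<close>). Hence \<open>\<beta>\<close> is
  asymptotic iff at every time \<open>C\<close> vanishes or the equation holds.

  It remains to exclude a curve that switches between the two alternatives, running along a ruling
  for a while and satisfying only the equation at other times. The mixed coefficient of the second
  fundamental form is \<open>\<mu> sin \<theta> / sqrt Q\<close>, whose numerator depends on \<open>s\<close> alone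
  (\<open>mixed_coefficient\<close>). When \<open>C = 0\<close>, unit speed forces \<open>D \<noteq> 0\<close>, so the equation holds at such a time iff
  \<open>\<mu> sin \<theta> = 0\<close> on the ruling through that point. If it fails there, continuity forces \<open>C = 0\<close> nearby,
  so the curve stays on the ruling, and by connectedness it never leaves it
  (\<open>zero_product_dichotomy\<close>). The argument needs the linear form to be continuous along the curve,
  which rests on the continuity of the derivatives of curvature and torsion (\<open>frenet_C1\<close>,
  \<open>torsion_C1\<close>).
\<close>

section \<open>Continuously differentiable functions\<close>

lemma smooth_on_has_vector_derivative:
  assumes "smooth_on f A" "x \<in> A"
  shows "(f has_vector_derivative vderiv f x) (at x)"
  using assms(1)[unfolded smooth_on_def, rule_format, of x 0] assms(2)
  by (simp add: vector_derivative_works)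

lemma smooth_on_vderiv:
  assumes "smooth_on f A"
  shows "smooth_on (vderiv f) A"
  unfolding smooth_on_def
proof (intro allI ballI)
  fix n x assume "x \<in> A"
  then show "((\<lambda>g. vderiv g) ^^ n) (vderiv f) differentiable (at x)"
    using assms[unfolded smooth_on_def, rule_format, of x "Suc n"]
    by (simp add: funpow_Suc_right del: funpow.simps)
qed

lemma smooth_on_imp_continuous_on: "smooth_on f A \<Longrightarrow> continuous_on A f"
  by (meson continuous_at_imp_continuous_on has_vector_derivative_continuous
      smooth_on_has_vector_derivative)

lemma smooth_on_imp_C1: "smooth_on f A \<Longrightarrow> f C1_differentiable_on A"
  unfolding C1_differentiable_on_def
  by (intro exI[of _ "vderiv f"] conjI ballI smooth_on_has_vector_derivative[of f A]
      smooth_on_imp_continuous_on smooth_on_vderiv)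

lemma C1_has_vector_derivative:
  "f C1_differentiable_on S \<Longrightarrow> x \<in> S \<Longrightarrow> (f has_vector_derivative vderiv f x) (at x)"
  by (simp add: C1_differentiable_on_eq vector_derivative_works)

lemma C1_continuous_on_vderiv:
  "f C1_differentiable_on S \<Longrightarrow> continuous_on S (vderiv f)"
  by (simp add: C1_differentiable_on_eq)

lemma C1_bounded_bilinear:
  assumes "bounded_bilinear h" "f C1_differentiable_on S" "g C1_differentiable_on S"
  shows "(\<lambda>x. h (f x) (g x)) C1_differentiable_on S"
  unfolding C1_differentiable_on_def
proof (intro exI conjI ballI)
  fix x assume "x \<in> S"
  then show "((\<lambda>x. h (f x) (g x)) has_vector_derivative
      h (f x) (vderiv g x) + h (vderiv f x) (g x)) (at x)"
    by (intro bounded_bilinear.has_vector_derivative[OF assms(1)]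
        C1_has_vector_derivative[OF assms(2)] C1_has_vector_derivative[OF assms(3)])
next
  show "continuous_on S (\<lambda>x. h (f x) (vderiv g x) + h (vderiv f x) (g x))"
    by (intro continuous_on_add bounded_bilinear.continuous_on[OF assms(1)]
        C1_continuous_on_vderiv C1_differentiable_imp_continuous_on assms)
qed

lemma C1_compose_real:
  fixes f :: "real \<Rightarrow> real"
  assumes f: "f C1_differentiable_on S"
    and g: "\<And>x. x \<in> S \<Longrightarrow> (g has_real_derivative g' (f x)) (at (f x))"
    and g': "continuous_on (f ` S) g'"
  shows "(\<lambda>x. g (f x)) C1_differentiable_on S"
  unfolding C1_differentiable_on_def
proof (intro exI conjI ballI)
  fix x assume "x \<in> S"
  then show "((\<lambda>x. g (f x)) has_vector_derivative vderiv f x * g' (f x)) (at x)"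
    using field_vector_diff_chain_at[OF C1_has_vector_derivative[OF f] g]
    by (simp add: o_def)
next
  show "continuous_on S (\<lambda>x. vderiv f x * g' (f x))"
    by (intro continuous_on_mult C1_continuous_on_vderiv f
        continuous_on_compose2[OF g' C1_differentiable_imp_continuous_on[OF f]]) auto
qed

lemma C1_cong_open:
  assumes "open S" "f C1_differentiable_on S" "\<And>x. x \<in> S \<Longrightarrow> g x = f x"
  shows "g C1_differentiable_on S"
  using assms has_vector_derivative_transform_within_open[of f _ _ S g]
  unfolding C1_differentiable_on_def by (metis (no_types, lifting))

section \<open>Orthonormal frames in three-space\<close>

lemma bounded_bilinear_cross3: "bounded_bilinear cross3"
  using bilinear_cross bilinear_conv_bounded_bilinear by blast

text \<open>The difference of the two sides is orthogonal to \<open>a\<close> and \<open>b\<close>, so by Lagrange's identity its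
  cross product with \<open>a \<times> b\<close> vanishes; it is also orthogonal to that nonzero vector, hence it is
  zero. This turns inner products with a moving frame into the derivative equations of the frame.\<close>
lemma orthonormal_expansion_cross3:
  fixes a b v :: "real ^ 3"
  assumes "a \<bullet> a = 1" "b \<bullet> b = 1" "a \<bullet> b = 0"
  shows "v = (v \<bullet> a) *\<^sub>R a + (v \<bullet> b) *\<^sub>R b + (v \<bullet> cross3 a b) *\<^sub>R cross3 a b"
proof (rule ccontr)
  define w where "w = v - ((v \<bullet> a) *\<^sub>R a + (v \<bullet> b) *\<^sub>R b + (v \<bullet> cross3 a b) *\<^sub>R cross3 a b)"
  have c: "cross3 a b \<bullet> cross3 a b = 1" "cross3 a b \<bullet> a = 0" "cross3 a b \<bullet> b = 0"
    using assms by (simp_all add: dot_cross dot_cross_self inner_commute)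
  have "w \<bullet> a = 0" "w \<bullet> b = 0" and wc: "w \<bullet> cross3 a b = 0"
    using assms c by (simp_all add: w_def inner_diff_left inner_add_left inner_commute[of b a]
      inner_commute[of a "cross3 a b"] inner_commute[of b "cross3 a b"])
  then have "cross3 w (cross3 a b) = 0"
    by (simp add: Lagrange)
  then have "w = 0"
    using wc c by (metis norm_and_cross_eq_0 inner_zero_left zero_neq_one)
  moreover assume "v \<noteq> (v \<bullet> a) *\<^sub>R a + (v \<bullet> b) *\<^sub>R b + (v \<bullet> cross3 a b) *\<^sub>R cross3 a b"
  ultimately show False by (simp add: w_def)
qed

lemma cross3_orthonormal:
  fixes a b :: "real ^ 3"
  assumes "a \<bullet> a = 1" "b \<bullet> b = 1" "a \<bullet> b = 0"
  shows "cross3 b (cross3 a b) = a" "cross3 (cross3 a b) a = b"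
  using assms by (simp_all add: Lagrange cross_skew[of "cross3 a b"] inner_commute)

text \<open>Differentiating a constant inner product. For the vectors of a moving orthonormal frame this
  makes the matrix of the derivatives antisymmetric.\<close>
lemma inner_vderiv_antisym:
  assumes "open S" "x \<in> S" "\<And>y. y \<in> S \<Longrightarrow> f y \<bullet> g y = c"
    and "(f has_vector_derivative f') (at x)" "(g has_vector_derivative g') (at x)"
  shows "f' \<bullet> g x = - (f x \<bullet> g')"
proof -
  have "((\<lambda>y. f y \<bullet> g y) has_vector_derivative f x \<bullet> g' + f' \<bullet> g x) (at x)"
    by (intro bounded_bilinear.has_vector_derivative[OF bounded_bilinear_inner] assms)
  moreover have "((\<lambda>y. f y \<bullet> g y) has_vector_derivative 0) (at x)"
    by (rule has_vector_derivative_transform_within_open[OF has_vector_derivative_const assms(1,2)])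
      (simp add: assms(3))
  ultimately show ?thesis
    using vector_derivative_unique_at by fastforce
qed

section \<open>The Frenet frame\<close>

lemma smooth_on_frenet_T: "frenet_curve \<alpha> I \<Longrightarrow> smooth_on (frenet_T \<alpha>) I"
  unfolding frenet_T_def[abs_def] frenet_curve_def by (blast intro: smooth_on_vderiv)

lemma frenet_orthonormal:
  assumes "open I" "frenet_curve \<alpha> I" "x \<in> I"
  shows "frenet_T \<alpha> x \<bullet> frenet_T \<alpha> x = 1" "frenet_N \<alpha> x \<bullet> frenet_N \<alpha> x = 1"
    "frenet_T \<alpha> x \<bullet> frenet_N \<alpha> x = 0"
proof -
  have T: "(frenet_T \<alpha> has_vector_derivative vderiv (frenet_T \<alpha>) y) (at y)" if "y \<in> I" for y
    using smooth_on_has_vector_derivative[OF smooth_on_frenet_T[OF assms(2)] that] .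
  have TT: "frenet_T \<alpha> y \<bullet> frenet_T \<alpha> y = 1" if "y \<in> I" for y
    using that assms(2) by (simp add: frenet_curve_def unit_speed_on_def frenet_T_def norm_eq_1)
  then show "frenet_T \<alpha> x \<bullet> frenet_T \<alpha> x = 1" using assms by blast
  have "vderiv (frenet_T \<alpha>) x \<bullet> frenet_T \<alpha> x = 0"
    using inner_vderiv_antisym[OF assms(1,3) TT T T] assms(3) by (simp add: inner_commute)
  then show "frenet_T \<alpha> x \<bullet> frenet_N \<alpha> x = 0"
    by (simp add: frenet_N_def inner_commute)
  have "curvature \<alpha> x \<noteq> 0" using assms by (simp add: frenet_curve_def)
  then show "frenet_N \<alpha> x \<bullet> frenet_N \<alpha> x = 1"
    by (simp add: frenet_N_def curvature_def dot_square_norm power2_eq_square)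
qed

lemma frenet_C1:
  assumes "open I" "frenet_curve \<alpha> I"
  shows "frenet_T \<alpha> C1_differentiable_on I" "curvature \<alpha> C1_differentiable_on I"
    "frenet_N \<alpha> C1_differentiable_on I" "frenet_B \<alpha> C1_differentiable_on I"
proof -
  have sm: "smooth_on (frenet_T \<alpha>) I"
    by (rule smooth_on_frenet_T[OF assms(2)])
  then show T: "frenet_T \<alpha> C1_differentiable_on I" by (rule smooth_on_imp_C1)
  have T': "vderiv (frenet_T \<alpha>) C1_differentiable_on I"
    by (intro smooth_on_imp_C1 smooth_on_vderiv sm)
  have k: "curvature \<alpha> x > 0" if "x \<in> I" for x
    using assms that by (simp add: frenet_curve_def curvature_def)
  have sq: "vderiv (frenet_T \<alpha>) x \<bullet> vderiv (frenet_T \<alpha>) x > 0" if "x \<in> I" for x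
    using k[OF that] by (simp add: curvature_def)
  have "(\<lambda>x. sqrt (vderiv (frenet_T \<alpha>) x \<bullet> vderiv (frenet_T \<alpha>) x)) C1_differentiable_on I"
    by (rule C1_compose_real[OF C1_bounded_bilinear[OF bounded_bilinear_inner T' T'],
          where g' = "\<lambda>y. inverse (sqrt y) / 2"])
      (use sq in \<open>force intro!: DERIV_real_sqrt continuous_intros\<close>)+
  then show K: "curvature \<alpha> C1_differentiable_on I"
    by (simp add: curvature_def[abs_def] norm_eq_sqrt_inner)
  have "(\<lambda>x. inverse (curvature \<alpha> x)) C1_differentiable_on I"
    by (rule C1_compose_real[OF K, where g' = "\<lambda>y. - (inverse y * inverse y)"])
      (use k in \<open>force intro!: derivative_eq_intros continuous_intros\<close>)+
  then show N: "frenet_N \<alpha> C1_differentiable_on I"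
    unfolding frenet_N_def[abs_def] by (intro C1_differentiable_on_scaleR T')
  show "frenet_B \<alpha> C1_differentiable_on I"
    unfolding frenet_B_def[abs_def] by (rule C1_bounded_bilinear[OF bounded_bilinear_cross3 T N])
qed

text \<open>The frame is orthonormal, so the matrix of \<open>(T', N', B')\<close> in it is antisymmetric. Two of its
  entries are given: \<open>T' \<bullet> N = \<kappa>\<close> and \<open>T' \<bullet> B = 0\<close> because \<open>N\<close> is defined as the direction of \<open>T'\<close>.
  The third, \<open>B' \<bullet> N\<close>, is \<open>- \<tau>\<close> by the definition of the torsion.\<close>
lemma frenet_equations:
  assumes "open I" "frenet_curve \<alpha> I" "x \<in> I"
  shows "(frenet_T \<alpha> has_vector_derivative curvature \<alpha> x *\<^sub>R frenet_N \<alpha> x) (at x)"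
    and "(frenet_N \<alpha> has_vector_derivative
      - curvature \<alpha> x *\<^sub>R frenet_T \<alpha> x + torsion \<alpha> x *\<^sub>R frenet_B \<alpha> x) (at x)"
    and "(frenet_B \<alpha> has_vector_derivative - torsion \<alpha> x *\<^sub>R frenet_N \<alpha> x) (at x)"
proof -
  note C1 = frenet_C1[OF assms(1,2)]
  note on = frenet_orthonormal[OF assms(1,2)]
  note T' = C1_has_vector_derivative[OF C1(1) assms(3)]
  note N' = C1_has_vector_derivative[OF C1(3) assms(3)]
  note B' = C1_has_vector_derivative[OF C1(4) assms(3)]
  have k: "curvature \<alpha> x \<noteq> 0"
    using assms by (simp add: frenet_curve_def)
  have T'eq: "vderiv (frenet_T \<alpha>) x = curvature \<alpha> x *\<^sub>R frenet_N \<alpha> x"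
    using k by (simp add: frenet_N_def)
  show "(frenet_T \<alpha> has_vector_derivative curvature \<alpha> x *\<^sub>R frenet_N \<alpha> x) (at x)"
    using T' by (simp only: T'eq)
  have BT: "frenet_B \<alpha> y \<bullet> frenet_T \<alpha> y = 0" and BN: "frenet_B \<alpha> y \<bullet> frenet_N \<alpha> y = 0" for y
    by (simp_all add: frenet_B_def dot_cross_self inner_commute)
  have BB: "frenet_B \<alpha> y \<bullet> frenet_B \<alpha> y = 1" if "y \<in> I" for y
    using on[OF that] by (simp add: frenet_B_def dot_cross inner_commute)
  have tau: "vderiv (frenet_B \<alpha>) x \<bullet> frenet_N \<alpha> x = - torsion \<alpha> x"
    by (simp add: torsion_def)
  have NT: "vderiv (frenet_N \<alpha>) x \<bullet> frenet_T \<alpha> x = - curvature \<alpha> x"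
    using inner_vderiv_antisym[OF assms(1,3) _ N' T', of 0] on assms(3)
    by (simp add: inner_commute T'eq)
  have NN: "vderiv (frenet_N \<alpha>) x \<bullet> frenet_N \<alpha> x = 0"
    using inner_vderiv_antisym[OF assms(1,3) _ N' N', of 1] on by (simp add: inner_commute)
  have NB: "vderiv (frenet_N \<alpha>) x \<bullet> frenet_B \<alpha> x = torsion \<alpha> x"
    using inner_vderiv_antisym[OF assms(1,3) _ N' B', of 0] BN tau by (simp add: inner_commute)
  have TB: "vderiv (frenet_B \<alpha>) x \<bullet> frenet_T \<alpha> x = 0"
    using inner_vderiv_antisym[OF assms(1,3) _ B' T', of 0] BT BN by (simp add: T'eq)
  have "vderiv (frenet_B \<alpha>) x \<bullet> frenet_B \<alpha> x = 0"
    using inner_vderiv_antisym[OF assms(1,3) _ B' B', of 1] BB by (simp add: inner_commute)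
  with orthonormal_expansion_cross3[OF on[OF assms(3)], of "vderiv (frenet_B \<alpha>) x"] tau TB B'
  show "(frenet_B \<alpha> has_vector_derivative - torsion \<alpha> x *\<^sub>R frenet_N \<alpha> x) (at x)"
    by (simp add: frenet_B_def[symmetric])
  from orthonormal_expansion_cross3[OF on[OF assms(3)], of "vderiv (frenet_N \<alpha>) x"] NT NN NB N'
  show "(frenet_N \<alpha> has_vector_derivative
      - curvature \<alpha> x *\<^sub>R frenet_T \<alpha> x + torsion \<alpha> x *\<^sub>R frenet_B \<alpha> x) (at x)"
    by (simp add: frenet_B_def[symmetric])
qed

text \<open>The defining formula of \<open>\<tau>\<close> involves \<open>B'\<close>, which is only known to be continuous from the
  lemmas above. Differentiating \<open>T' = \<kappa> N\<close> once more gives \<open>T'' \<bullet> B = \<kappa> \<tau>\<close>, and in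
  \<open>\<tau> = ((T \<times> N) \<bullet> T'') / \<kappa>\<close> all ingredients are continuously differentiable.\<close>
lemma torsion_C1:
  assumes "open I" "frenet_curve \<alpha> I"
  shows "torsion \<alpha> C1_differentiable_on I"
proof (rule C1_cong_open[OF assms(1)])
  let ?T' = "vderiv (frenet_T \<alpha>)"
  let ?i = "\<lambda>x. inverse (curvature \<alpha> x)"
  have sm: "smooth_on ?T' I"
    by (intro smooth_on_vderiv smooth_on_frenet_T assms)
  have i: "?i C1_differentiable_on I"
    by (rule C1_compose_real[OF frenet_C1(2)[OF assms], where g' = "\<lambda>y. - (inverse y * inverse y)"])
      (use assms in \<open>force intro!: derivative_eq_intros continuous_intros simp: frenet_curve_def\<close>)+
  show "(\<lambda>x. (cross3 (frenet_T \<alpha> x) (frenet_N \<alpha> x) \<bullet> vderiv ?T' x) * ?i x) C1_differentiable_on I"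
    by (intro C1_differentiable_on_mult i C1_bounded_bilinear[OF bounded_bilinear_inner]
        C1_bounded_bilinear[OF bounded_bilinear_cross3] frenet_C1[OF assms]
        smooth_on_imp_C1 smooth_on_vderiv sm)
  fix x assume x: "x \<in> I"
  have k: "curvature \<alpha> x \<noteq> 0" using assms x by (simp add: frenet_curve_def)
  have "(?T' has_vector_derivative
      curvature \<alpha> x *\<^sub>R (- curvature \<alpha> x *\<^sub>R frenet_T \<alpha> x + torsion \<alpha> x *\<^sub>R frenet_B \<alpha> x)
      + vderiv (curvature \<alpha>) x *\<^sub>R frenet_N \<alpha> x) (at x)"
  proof (rule has_vector_derivative_transform_within_open[OF _ assms(1) x])
    show "((\<lambda>y. curvature \<alpha> y *\<^sub>R frenet_N \<alpha> y) has_vector_derivative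
        curvature \<alpha> x *\<^sub>R (- curvature \<alpha> x *\<^sub>R frenet_T \<alpha> x + torsion \<alpha> x *\<^sub>R frenet_B \<alpha> x)
        + vderiv (curvature \<alpha>) x *\<^sub>R frenet_N \<alpha> x) (at x)"
      by (intro bounded_bilinear.has_vector_derivative[OF bounded_bilinear_scaleR]
          frenet_equations[OF assms x] C1_has_vector_derivative[OF frenet_C1(2)[OF assms] x])
  qed (use assms in \<open>simp add: frenet_N_def frenet_curve_def\<close>)
  then have "vderiv ?T' x =
      curvature \<alpha> x *\<^sub>R (- curvature \<alpha> x *\<^sub>R frenet_T \<alpha> x + torsion \<alpha> x *\<^sub>R frenet_B \<alpha> x)
      + vderiv (curvature \<alpha>) x *\<^sub>R frenet_N \<alpha> x"
    by (rule vector_derivative_at)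
  moreover have "frenet_B \<alpha> x \<bullet> frenet_T \<alpha> x = 0" "frenet_B \<alpha> x \<bullet> frenet_N \<alpha> x = 0"
    "frenet_B \<alpha> x \<bullet> frenet_B \<alpha> x = 1"
    using frenet_orthonormal[OF assms x]
    by (simp_all add: frenet_B_def dot_cross dot_cross_self inner_commute)
  ultimately show "torsion \<alpha> x = (cross3 (frenet_T \<alpha> x) (frenet_N \<alpha> x) \<bullet> vderiv ?T' x) * ?i x"
    using k by (simp add: frenet_B_def[symmetric] inner_add_right inner_diff_right)
qed

section \<open>Ruled maps and normal curvature\<close>

text \<open>This is used twice: for the surface itself, and for its normal field, which is affine in \<open>u\<close>
  as well.\<close>
lemma ruled_map_has_derivative:
  fixes a q :: "real \<Rightarrow> 'a::real_normed_vector"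
  assumes "(a has_vector_derivative a') (at s)" "(q has_vector_derivative q') (at s)"
  shows "((\<lambda>(s, u). a s + u *\<^sub>R q s) has_derivative
    (\<lambda>w. fst w *\<^sub>R (a' + u *\<^sub>R q') + snd w *\<^sub>R q s)) (at (s, u))"
proof -
  have comp: "((\<lambda>p. h (fst p)) has_derivative (\<lambda>w. fst w *\<^sub>R h')) (at (s, u))"
    if "(h has_vector_derivative h') (at s)" for h :: "real \<Rightarrow> 'a" and h'
    using has_derivative_compose[OF has_derivative_fst[OF has_derivative_ident],
        where x = "(s, u)" and g = h and g' = "\<lambda>x. x *\<^sub>R h'"] that
    by (simp add: has_vector_derivative_def)
  have "((\<lambda>p. a (fst p) + snd p *\<^sub>R q (fst p)) has_derivative
      (\<lambda>w. fst w *\<^sub>R a' + (snd (s, u) *\<^sub>R fst w *\<^sub>R q' + snd w *\<^sub>R q (fst (s, u)))))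
      (at (s, u))"
    by (intro has_derivative_add has_derivative_scaleR comp assms has_derivative_snd
        has_derivative_ident)
  then show ?thesis
    by (simp add: case_prod_unfold algebra_simps)
qed

text \<open>Normalizing a vector field changes its derivative only by the factor \<open>1 / norm (n p)\<close> and by a
  multiple of \<open>n p\<close> itself. In the Weingarten map that multiple is invisible, being orthogonal to
  the tangent plane, so its coefficient can stay unspecified.\<close>
lemma normalized_has_derivative:
  fixes n :: "'a::real_normed_vector \<Rightarrow> 'b::real_inner"
  assumes n: "(n has_derivative n') (at p)" and "n p \<noteq> 0"
  obtains c where "((\<lambda>x. n x /\<^sub>R norm (n x)) has_derivative
    (\<lambda>w. n' w /\<^sub>R norm (n p) + c w *\<^sub>R n p)) (at p)"
proof
  have "((\<lambda>x. norm (n x)) has_derivative (\<lambda>w. n' w \<bullet> sgn (n p))) (at p)"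
    using has_derivative_compose[OF n has_derivative_norm[OF assms(2)]] by simp
  then have "((\<lambda>x. inverse (norm (n x))) has_derivative
      (\<lambda>w. - (inverse (norm (n p)) * (n' w \<bullet> sgn (n p)) * inverse (norm (n p))))) (at p)"
    by (rule Deriv.has_derivative_inverse[rotated]) (use assms in auto)
  from has_derivative_scaleR[OF this n]
  show "((\<lambda>x. n x /\<^sub>R norm (n x)) has_derivative (\<lambda>w. n' w /\<^sub>R norm (n p)
    + (- (inverse (norm (n p)) * (n' w \<bullet> sgn (n p)) * inverse (norm (n p)))) *\<^sub>R n p)) (at p)"
    by (simp add: mult_ac)
qed

lemma cross3_nonzero_imp_inj:
  fixes a b :: "real ^ 3"
  assumes "cross3 a b \<noteq> 0" "x *\<^sub>R a + y *\<^sub>R b = x' *\<^sub>R a + y' *\<^sub>R b"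
  shows "x = x'" "y = y'"
proof -
  have "cross3 (x *\<^sub>R a + y *\<^sub>R b) b = cross3 (x' *\<^sub>R a + y' *\<^sub>R b) b"
    "cross3 a (x *\<^sub>R a + y *\<^sub>R b) = cross3 a (x' *\<^sub>R a + y' *\<^sub>R b)"
    using assms(2) by simp_all
  then show "x = x'" "y = y'"
    using assms(1)
    by (simp_all add: cross_add_left cross_add_right cross_mult_left cross_mult_right)
qed

text \<open>The normal curvature can be read off from any formula \<open>n\<close> for the unnormalized normal field near
  \<open>p\<close>. Regularity makes the coordinates of a tangent vector unique, which resolves the description
  operator in the Weingarten map.\<close>
lemma normal_curvature_eq:
  assumes X: "(X has_derivative (\<lambda>w. fst w *\<^sub>R Xs + snd w *\<^sub>R Xu)) (at p)"
    and S: "open S" "p \<in> S" "\<And>x. x \<in> S \<Longrightarrow> normal_vec X x = n x"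
    and n: "(n has_derivative n') (at p)"
    and reg: "regular_point X p"
  shows "normal_curvature X p (c *\<^sub>R Xs + d *\<^sub>R Xu) =
    - (n' (c, d) \<bullet> (c *\<^sub>R Xs + d *\<^sub>R Xu)) / norm (n p)"
proof -
  let ?v = "c *\<^sub>R Xs + d *\<^sub>R Xu"
  have tan: "tangent_map X p = (\<lambda>w. fst w *\<^sub>R Xs + snd w *\<^sub>R Xu)"
    using frechet_derivative_at[OF X] by (simp add: tangent_map_def)
  have np: "n p = cross3 Xs Xu"
    using S(3)[OF S(2)] by (simp add: normal_vec_def tan)
  have nz: "n p \<noteq> 0"
    using reg S by (simp add: regular_point_def)
  have the: "(THE w. tangent_map X p w = ?v) = (c, d)"
  proof (rule the_equality)
    fix w assume "tangent_map X p w = ?v"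
    then show "w = (c, d)"
      using cross3_nonzero_imp_inj[of Xs Xu] nz by (metis np tan prod.collapse)
  qed (simp add: tan)
  obtain k where "((\<lambda>x. n x /\<^sub>R norm (n x)) has_derivative
      (\<lambda>w. n' w /\<^sub>R norm (n p) + k w *\<^sub>R n p)) (at p)"
    using normalized_has_derivative[OF n nz] .
  then have "(unit_normal X has_derivative (\<lambda>w. n' w /\<^sub>R norm (n p) + k w *\<^sub>R n p)) (at p)"
    by (rule has_derivative_transform_within_open[OF _ S(1,2)]) (simp add: unit_normal_def S(3))
  then have "weingarten X p ?v = - (n' (c, d) /\<^sub>R norm (n p) + k (c, d) *\<^sub>R n p)"
    by (simp add: weingarten_def the frechet_derivative_at[symmetric])
  moreover have "n p \<bullet> ?v = 0"
    by (simp add: np inner_add_right dot_cross_self)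
  ultimately show ?thesis
    by (simp add: normal_curvature_def inner_diff_left inner_add_left divide_inverse_commute)
qed

section \<open>The second fundamental form of an osculating-type ruled surface\<close>

text \<open>The vector \<open>r\<close> completing \<open>q\<close> and \<open>B\<close> to an orthonormal frame; it is tangent to the osculating
  plane of the curve. All computations on the surface are done in the frame \<open>(q, r, B)\<close>.\<close>
definition OT_conormal :: "(real \<Rightarrow> R3) \<Rightarrow> (real \<Rightarrow> real) \<Rightarrow> real \<Rightarrow> R3" where
  "OT_conormal \<alpha> \<theta> s = sin (\<theta> s) *\<^sub>R frenet_T \<alpha> s - cos (\<theta> s) *\<^sub>R frenet_N \<alpha> s"

definition OT_normal :: "(real \<Rightarrow> R3) \<Rightarrow> (real \<Rightarrow> real) \<Rightarrow> real \<times> real \<Rightarrow> R3" where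
  "OT_normal \<alpha> \<theta> = (\<lambda>(s, u). OT_f \<alpha> \<theta> s u *\<^sub>R frenet_B \<alpha> s - OT_g \<alpha> \<theta> s u *\<^sub>R OT_conormal \<alpha> \<theta> s)"

locale OT_ruled =
  fixes \<alpha> :: "real \<Rightarrow> R3" and \<theta> :: "real \<Rightarrow> real" and I :: "real set"
  assumes op: "open I" and fc: "frenet_curve \<alpha> I" and th: "smooth_on \<theta> I"
begin

abbreviation "q \<equiv> OT_direction \<alpha> \<theta>"
abbreviation "r \<equiv> OT_conormal \<alpha> \<theta>"
abbreviation "b \<equiv> frenet_B \<alpha>"
abbreviation "\<eta> \<equiv> OT_eta \<alpha> \<theta>"
abbreviation "\<mu> \<equiv> OT_mu \<alpha> \<theta>"
abbreviation "\<xi> \<equiv> OT_xi \<alpha> \<theta>"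
abbreviation "f \<equiv> OT_f \<alpha> \<theta>"
abbreviation "g \<equiv> OT_g \<alpha> \<theta>"

lemma theta_derivative:
  assumes "s \<in> I"
  shows "(\<theta> has_real_derivative deriv \<theta> s) (at s)"
  using smooth_on_has_vector_derivative[OF th assms]
  by (simp add: has_real_derivative_iff_has_vector_derivative field_derivative_eq_vector_derivative)

lemma frame_orthonormal:
  assumes "s \<in> I"
  shows "q s \<bullet> q s = 1" "r s \<bullet> r s = 1" "b s \<bullet> b s = 1"
    "q s \<bullet> r s = 0" "q s \<bullet> b s = 0" "r s \<bullet> b s = 0"
    "r s \<bullet> q s = 0" "b s \<bullet> q s = 0" "b s \<bullet> r s = 0"
  using frenet_orthonormal[OF op fc assms] sin_cos_squared_add[of "\<theta> s"]
  by (auto simp: OT_direction_def OT_conormal_def frenet_B_def inner_add_left inner_add_right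
      inner_diff_left inner_diff_right dot_cross dot_cross_self inner_commute power2_eq_square)

lemma frame_cross:
  assumes "s \<in> I"
  shows "cross3 (r s) (q s) = b s" "cross3 (b s) (q s) = - r s"
proof -
  note on = frenet_orthonormal[OF op fc assms]
  have "cross3 (r s) (q s) = ((sin (\<theta> s))\<^sup>2 + (cos (\<theta> s))\<^sup>2) *\<^sub>R b s"
    by (simp add: OT_direction_def OT_conormal_def frenet_B_def cross_add_right
        Cross3.left_diff_distrib cross_mult_left cross_mult_right scaleR_add_left power2_eq_square
        cross_skew[of "frenet_N \<alpha> s" "frenet_T \<alpha> s"])
  then show "cross3 (r s) (q s) = b s" by simp
  show "cross3 (b s) (q s) = - r s"
    using cross3_orthonormal[OF on]
    by (simp add: OT_direction_def OT_conormal_def frenet_B_def cross_add_right cross_mult_right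
        cross_skew[of "cross3 _ _" "frenet_N \<alpha> s"])
qed

text \<open>The frame \<open>(q, r, B)\<close> is the Frenet frame turned about \<open>B\<close> by the angle \<open>\<theta>\<close> (and with one
  vector reversed). The rotation in the osculating plane adds \<open>\<theta>'\<close> to the rate \<open>\<kappa>\<close>, and the torsion
  is distributed over \<open>q\<close> and \<open>r\<close> as \<open>\<mu>\<close> and \<open>\<xi>\<close>.\<close>
lemma frame_derivatives:
  assumes "s \<in> I"
  shows "(q has_vector_derivative - \<eta> s *\<^sub>R r s + \<mu> s *\<^sub>R b s) (at s)"
    and "(r has_vector_derivative \<eta> s *\<^sub>R q s - \<xi> s *\<^sub>R b s) (at s)"
    and "(b has_vector_derivative - \<mu> s *\<^sub>R q s + \<xi> s *\<^sub>R r s) (at s)"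
proof -
  note fr = frenet_equations[OF op fc assms]
  have sn: "((\<lambda>s. sin (\<theta> s)) has_real_derivative cos (\<theta> s) * deriv \<theta> s) (at s)"
    and cs: "((\<lambda>s. cos (\<theta> s)) has_real_derivative - sin (\<theta> s) * deriv \<theta> s) (at s)"
    by (auto intro!: derivative_eq_intros theta_derivative[OF assms])
  show "(q has_vector_derivative - \<eta> s *\<^sub>R r s + \<mu> s *\<^sub>R b s) (at s)"
    unfolding OT_direction_def[abs_def]
    by (rule has_vector_derivative_eq_rhs[OF has_vector_derivative_add[OF
          has_vector_derivative_scaleR[OF cs fr(1)] has_vector_derivative_scaleR[OF sn fr(2)]]])
      (simp add: OT_eta_def OT_mu_def OT_conormal_def algebra_simps)
  show "(r has_vector_derivative \<eta> s *\<^sub>R q s - \<xi> s *\<^sub>R b s) (at s)"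
    unfolding OT_conormal_def[abs_def]
    by (rule has_vector_derivative_eq_rhs[OF has_vector_derivative_diff[OF
          has_vector_derivative_scaleR[OF sn fr(1)] has_vector_derivative_scaleR[OF cs fr(2)]]])
      (simp add: OT_eta_def OT_xi_def OT_direction_def algebra_simps)
  have "frenet_N \<alpha> s = (cos (\<theta> s) * cos (\<theta> s) + sin (\<theta> s) * sin (\<theta> s)) *\<^sub>R frenet_N \<alpha> s"
    by simp
  also have "\<dots> = sin (\<theta> s) *\<^sub>R q s - cos (\<theta> s) *\<^sub>R r s"
    unfolding OT_direction_def OT_conormal_def
    by (simp add: algebra_simps del: sin_cos_squared_add3)
  finally have N: "frenet_N \<alpha> s = sin (\<theta> s) *\<^sub>R q s - cos (\<theta> s) *\<^sub>R r s" .
  have "- torsion \<alpha> s *\<^sub>R frenet_N \<alpha> s = - \<mu> s *\<^sub>R q s + \<xi> s *\<^sub>R r s"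
    unfolding N by (simp add: OT_mu_def OT_xi_def algebra_simps)
  with fr(3) show "(b has_vector_derivative - \<mu> s *\<^sub>R q s + \<xi> s *\<^sub>R r s) (at s)" by simp
qed

lemma frenet_T_in_frame: "frenet_T \<alpha> s = cos (\<theta> s) *\<^sub>R q s + sin (\<theta> s) *\<^sub>R r s"
proof -
  have "frenet_T \<alpha> s = (cos (\<theta> s) * cos (\<theta> s) + sin (\<theta> s) * sin (\<theta> s)) *\<^sub>R frenet_T \<alpha> s"
    by simp
  also have "\<dots> = cos (\<theta> s) *\<^sub>R q s + sin (\<theta> s) *\<^sub>R r s"
    unfolding OT_direction_def OT_conormal_def
    by (simp add: algebra_simps del: sin_cos_squared_add3)
  finally show ?thesis .
qed

text \<open>Since \<open>T = cos \<theta> q + sin \<theta> r\<close>, the derivative along the curve of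
  \<open>\<alpha> + u q\<close> is \<open>cos \<theta> q + (sin \<theta> - u \<eta>) r + u \<mu> B\<close>: the functions \<open>f\<close> and \<open>g\<close> are coordinates of
  this tangent vector.\<close>
lemma surface_derivative:
  assumes "s \<in> I"
  shows "(OT_surface \<alpha> \<theta> has_derivative
    (\<lambda>w. fst w *\<^sub>R (cos (\<theta> s) *\<^sub>R q s + f s u *\<^sub>R r s + g s u *\<^sub>R b s) + snd w *\<^sub>R q s)) (at (s, u))"
proof -
  have "(\<alpha> has_vector_derivative frenet_T \<alpha> s) (at s)"
    using smooth_on_has_vector_derivative[of \<alpha> I s] fc assms
    by (simp add: frenet_curve_def frenet_T_def)
  from ruled_map_has_derivative[OF this frame_derivatives(1)[OF assms], of u]
  show ?thesis
    by (simp add: OT_surface_def frenet_T_in_frame OT_f_def OT_g_def algebra_simps)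
qed

lemma normal_vec_eq:
  assumes "s \<in> I"
  shows "normal_vec (OT_surface \<alpha> \<theta>) (s, u) = OT_normal \<alpha> \<theta> (s, u)"
  unfolding normal_vec_def tangent_map_def
    frechet_derivative_at[OF surface_derivative[OF assms], symmetric]
  by (simp add: OT_normal_def cross_add_left cross_mult_left frame_cross[OF assms])

lemma norm_OT_normal:
  assumes "s \<in> I"
  shows "norm (OT_normal \<alpha> \<theta> (s, u)) = sqrt (OT_Q \<alpha> \<theta> s u)"
  by (simp add: norm_eq_sqrt_inner OT_normal_def OT_Q_def inner_diff_left inner_diff_right
      frame_orthonormal[OF assms] power2_eq_square)

lemma regular_point_iff:
  assumes "s \<in> I"
  shows "regular_point (OT_surface \<alpha> \<theta>) (s, u) \<longleftrightarrow> OT_Q \<alpha> \<theta> s u > 0"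
proof -
  have "OT_Q \<alpha> \<theta> s u \<ge> 0" by (simp add: OT_Q_def)
  moreover have "regular_point (OT_surface \<alpha> \<theta>) (s, u) \<longleftrightarrow> norm (OT_normal \<alpha> \<theta> (s, u)) \<noteq> 0"
    by (simp add: regular_point_def normal_vec_eq[OF assms])
  ultimately show ?thesis
    by (simp add: norm_OT_normal[OF assms] less_le)
qed

lemma eta_mu_C1: "\<eta> C1_differentiable_on I" "\<mu> C1_differentiable_on I"
proof -
  have t: "\<theta> C1_differentiable_on I" "deriv \<theta> C1_differentiable_on I"
    using smooth_on_imp_C1[OF th] smooth_on_imp_C1[OF smooth_on_vderiv[OF th]]
    by (simp_all add: field_derivative_eq_vector_derivative[abs_def])
  show "\<eta> C1_differentiable_on I"
    unfolding OT_eta_def[abs_def] by (intro C1_differentiable_on_add t frenet_C1[OF op fc])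
  show "\<mu> C1_differentiable_on I"
    unfolding OT_mu_def[abs_def]
    by (intro C1_differentiable_on_mult torsion_C1[OF op fc]
        C1_compose_real[OF t(1), where g' = cos] DERIV_sin continuous_intros)
qed

lemma eta_mu_derivatives:
  assumes "s \<in> I"
  shows "(\<eta> has_real_derivative deriv \<eta> s) (at s)" "(\<mu> has_real_derivative deriv \<mu> s) (at s)"
  using C1_has_vector_derivative[OF eta_mu_C1(1) assms] C1_has_vector_derivative[OF eta_mu_C1(2) assms]
  by (simp_all add: has_real_derivative_iff_has_vector_derivative field_derivative_eq_vector_derivative)

lemma fg_derivatives:
  assumes "s \<in> I"
  shows "((\<lambda>x. f x u) has_real_derivative cos (\<theta> s) * deriv \<theta> s - u * deriv \<eta> s) (at s)"
    and "((\<lambda>x. g x u) has_real_derivative u * deriv \<mu> s) (at s)"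
proof -
  note [derivative_intros] = theta_derivative[OF assms] eta_mu_derivatives[OF assms]
  show "((\<lambda>x. f x u) has_real_derivative cos (\<theta> s) * deriv \<theta> s - u * deriv \<eta> s) (at s)"
    unfolding OT_f_def by (auto intro!: derivative_eq_intros)
  show "((\<lambda>x. g x u) has_real_derivative u * deriv \<mu> s) (at s)"
    unfolding OT_g_def by (auto intro!: derivative_eq_intros)
qed

lemma W_eq:
  assumes "s \<in> I"
  shows "OT_W \<alpha> \<theta> s u = g s u * (cos (\<theta> s) * deriv \<theta> s - u * deriv \<eta> s) - f s u * (u * deriv \<mu> s)"
  using fg_derivatives[OF assms, of u, THEN DERIV_imp_deriv] by (simp add: OT_W_def)

text \<open>The terms with \<open>u\<close> cancel. Up to the length of the normal this is the mixed coefficient of the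
  second fundamental form, so that coefficient, apart from the factor \<open>1 / sqrt Q\<close>, is the same
  along a whole ruling. The dichotomy in the theorem rests on this.\<close>
lemma mixed_coefficient: "f s u * \<mu> s + g s u * \<eta> s = \<mu> s * sin (\<theta> s)"
  by (simp add: OT_f_def OT_g_def algebra_simps)

text \<open>The coefficient of \<open>ds\<^sup>2\<close> in the second fundamental form, times the length \<open>sqrt Q\<close> of the
  unnormalized normal.\<close>
definition "second_ss s u = cos (\<theta> s) * \<mu> s * sin (\<theta> s) - OT_Q \<alpha> \<theta> s u * \<xi> s - OT_W \<alpha> \<theta> s u"

lemma normal_derivative:
  assumes "s \<in> I"
  obtains n' where "(OT_normal \<alpha> \<theta> has_derivative n') (at (s, u))"
    "\<And>C D. n' (C, D) = C *\<^sub>R (deriv (\<lambda>x. f x u) s *\<^sub>R b s + f s u *\<^sub>R (- \<mu> s *\<^sub>R q s + \<xi> s *\<^sub>R r s)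
        - deriv (\<lambda>x. g x u) s *\<^sub>R r s - g s u *\<^sub>R (\<eta> s *\<^sub>R q s - \<xi> s *\<^sub>R b s))
      + D *\<^sub>R (- \<eta> s *\<^sub>R b s - \<mu> s *\<^sub>R r s)"
proof -
  note fd = frame_derivatives[OF assms]
  have "((\<lambda>s. sin (\<theta> s)) has_real_derivative cos (\<theta> s) * deriv \<theta> s) (at s)"
    by (auto intro!: derivative_eq_intros theta_derivative[OF assms])
  note a = has_vector_derivative_scaleR[OF this fd(3)]
  \<comment> \<open>Sorting by powers of \<open>u\<close> exhibits the normal field as a ruled map.\<close>
  have n: "OT_normal \<alpha> \<theta> = (\<lambda>(s, u). sin (\<theta> s) *\<^sub>R b s + u *\<^sub>R (- (\<eta> s *\<^sub>R b s) - \<mu> s *\<^sub>R r s))"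
    by (auto simp: OT_normal_def OT_f_def OT_g_def algebra_simps)
  show ?thesis
    by (rule that[OF ruled_map_has_derivative[OF a has_vector_derivative_diff[OF
          has_vector_derivative_minus[OF has_vector_derivative_scaleR[OF eta_mu_derivatives(1)[OF assms] fd(3)]]
          has_vector_derivative_scaleR[OF eta_mu_derivatives(2)[OF assms] fd(2)]], of u, folded n]])
      (simp only: fg_derivatives[OF assms, of u, THEN DERIV_imp_deriv],
        simp add: OT_f_def OT_g_def algebra_simps)
qed

text \<open>There is no term in \<open>D\<^sup>2\<close>, because the rulings are straight lines. So \<open>C\<close> splits off from the
  second fundamental form, and the other factor is linear in \<open>(C, D)\<close>.\<close>
lemma normal_curvature_OT:
  assumes "s \<in> I" "regular_point (OT_surface \<alpha> \<theta>) (s, u)"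
  shows "normal_curvature (OT_surface \<alpha> \<theta>) (s, u)
      (C *\<^sub>R (cos (\<theta> s) *\<^sub>R q s + f s u *\<^sub>R r s + g s u *\<^sub>R b s) + D *\<^sub>R q s) =
    C * ((C * second_ss s u + 2 * D * (\<mu> s * sin (\<theta> s))) / sqrt (OT_Q \<alpha> \<theta> s u))"
proof -
  obtain n' where n': "(OT_normal \<alpha> \<theta> has_derivative n') (at (s, u))"
    and n'_eq: "\<And>C D. n' (C, D) = C *\<^sub>R (deriv (\<lambda>x. f x u) s *\<^sub>R b s + f s u *\<^sub>R (- \<mu> s *\<^sub>R q s + \<xi> s *\<^sub>R r s)
        - deriv (\<lambda>x. g x u) s *\<^sub>R r s - g s u *\<^sub>R (\<eta> s *\<^sub>R q s - \<xi> s *\<^sub>R b s))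
      + D *\<^sub>R (- \<eta> s *\<^sub>R b s - \<mu> s *\<^sub>R r s)"
    using normal_derivative[OF assms(1), where u = u] by blast
  let ?v = "C *\<^sub>R (cos (\<theta> s) *\<^sub>R q s + f s u *\<^sub>R r s + g s u *\<^sub>R b s) + D *\<^sub>R q s"
  have "- (n' (C, D) \<bullet> ?v) = C * (C * (cos (\<theta> s) * (f s u * \<mu> s + g s u * \<eta> s)
      - OT_Q \<alpha> \<theta> s u * \<xi> s - OT_W \<alpha> \<theta> s u) + 2 * D * (f s u * \<mu> s + g s u * \<eta> s))"
    by (simp add: n'_eq inner_add_left inner_add_right inner_diff_left inner_diff_right
        frame_orthonormal[OF assms(1)] OT_Q_def OT_W_def algebra_simps power2_eq_square)
  then have "- (n' (C, D) \<bullet> ?v) = C * (C * second_ss s u + 2 * D * (\<mu> s * sin (\<theta> s)))"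
    unfolding mixed_coefficient by (simp add: second_ss_def mult_ac)
  moreover have "normal_curvature (OT_surface \<alpha> \<theta>) (s, u) ?v =
      - (n' (C, D) \<bullet> ?v) / norm (OT_normal \<alpha> \<theta> (s, u))"
    by (rule normal_curvature_eq[OF surface_derivative[OF assms(1)], where S = "I \<times> UNIV"])
      (use assms n' op in \<open>auto intro: open_Times simp: normal_vec_eq\<close>)
  ultimately show ?thesis
    by (simp add: norm_OT_normal[OF assms(1)])
qed

text \<open>The sum \<open>A\<^sub>1 cos \<theta> + A\<^sub>2\<close> is the mixed coefficient \<open>S(X\<^sub>s) \<bullet> X\<^sub>u\<close> and \<open>B\<^sub>1 Q\<close> is the same
  coefficient computed as \<open>S(X\<^sub>u) \<bullet> X\<^sub>s\<close>. Together with \<open>A\<^sub>1 Q\<close> they reassemble the second factor of the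
  normal curvature.\<close>
lemma equation_eq:
  assumes "OT_Q \<alpha> \<theta> s u > 0"
  shows "(C * cos (\<theta> s) + D) * (OT_A1 \<alpha> \<theta> s u * cos (\<theta> s) + OT_A2 \<alpha> \<theta> s u)
      + (C * OT_A1 \<alpha> \<theta> s u + D * OT_B1 \<alpha> \<theta> s u) * ((f s u)\<^sup>2 + (g s u)\<^sup>2)
    = (C * second_ss s u + 2 * D * (\<mu> s * sin (\<theta> s))) / sqrt (OT_Q \<alpha> \<theta> s u)"
proof -
  define Q where "Q = OT_Q \<alpha> \<theta> s u"
  define R where "R = sqrt Q"
  have Q: "Q > 0" using assms by (simp add: Q_def)
  then have R: "R > 0" "Q = R * R" by (simp_all add: R_def)
  have pw: "Q powr (3/2) = Q * R"
    using powr_add[of Q 1 "1/2"] Q by (simp add: R_def powr_half_sqrt)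
  have M: "OT_A1 \<alpha> \<theta> s u * cos (\<theta> s) + OT_A2 \<alpha> \<theta> s u = \<mu> s * sin (\<theta> s) / R"
    using R unfolding OT_A1_def OT_A2_def Q_def[symmetric] pw mixed_coefficient
    by (simp add: field_simps)
  have B: "OT_B1 \<alpha> \<theta> s u * Q = \<mu> s * sin (\<theta> s) / R"
    using R Q unfolding OT_B1_def Q_def[symmetric] pw by simp
  have A: "OT_A1 \<alpha> \<theta> s u * Q = - (OT_W \<alpha> \<theta> s u + Q * \<xi> s) / R"
    using R Q unfolding OT_A1_def Q_def[symmetric] pw by (simp add: field_simps)
  have "(C * cos (\<theta> s) + D) * (OT_A1 \<alpha> \<theta> s u * cos (\<theta> s) + OT_A2 \<alpha> \<theta> s u)
      + (C * OT_A1 \<alpha> \<theta> s u + D * OT_B1 \<alpha> \<theta> s u) * Q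
    = (C * cos (\<theta> s) + D) * (\<mu> s * sin (\<theta> s) / R)
      + C * (- (OT_W \<alpha> \<theta> s u + Q * \<xi> s) / R) + D * (\<mu> s * sin (\<theta> s) / R)"
    unfolding M A[symmetric] B[symmetric] by (simp add: algebra_simps)
  also have "\<dots> = (C * second_ss s u + 2 * D * (\<mu> s * sin (\<theta> s))) / R"
    using R(1) unfolding second_ss_def Q_def[symmetric] by (simp add: field_simps)
  finally show ?thesis
    unfolding R_def Q_def by (simp add: OT_Q_def)
qed

text \<open>The function contains the derivatives of \<open>\<eta>\<close> and \<open>\<mu>\<close>, hence those of curvature and torsion;
  this is where their continuity enters.\<close>
lemma continuous_on_second_ss:
  fixes J :: "real set"
  assumes "continuous_on J s" "continuous_on J u" "s ` J \<subseteq> I"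
  shows "continuous_on J (\<lambda>t. second_ss (s t) (u t))"
proof -
  have c: "continuous_on J (\<lambda>t. h (s t))" if "continuous_on I h" for h :: "real \<Rightarrow> real"
    by (rule continuous_on_compose2[OF that assms(1,3)])
  note cC1 = C1_differentiable_imp_continuous_on
  have [continuous_intros]: "continuous_on J (\<lambda>t. \<theta> (s t))" "continuous_on J (\<lambda>t. deriv \<theta> (s t))"
    "continuous_on J (\<lambda>t. torsion \<alpha> (s t))"
    "continuous_on J (\<lambda>t. \<eta> (s t))" "continuous_on J (\<lambda>t. deriv \<eta> (s t))"
    "continuous_on J (\<lambda>t. \<mu> (s t))" "continuous_on J (\<lambda>t. deriv \<mu> (s t))"
    unfolding field_derivative_eq_vector_derivative
    by (intro c cC1 eta_mu_C1 torsion_C1[OF op fc] C1_continuous_on_vderiv smooth_on_imp_C1 th)+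
  have "continuous_on J (\<lambda>t. cos (\<theta> (s t)) * \<mu> (s t) * sin (\<theta> (s t))
      - ((sin (\<theta> (s t)) - u t * \<eta> (s t))\<^sup>2 + (u t * \<mu> (s t))\<^sup>2) * (torsion \<alpha> (s t) * cos (\<theta> (s t)))
      - (u t * \<mu> (s t) * (cos (\<theta> (s t)) * deriv \<theta> (s t) - u t * deriv \<eta> (s t))
         - (sin (\<theta> (s t)) - u t * \<eta> (s t)) * (u t * deriv \<mu> (s t))))"
    by (intro continuous_intros assms)
  then show ?thesis
    by (rule continuous_on_eq)
      (use assms(3) in \<open>auto simp: second_ss_def W_eq OT_Q_def OT_f_def OT_g_def OT_xi_def image_subset_iff\<close>)
qed

end

section \<open>Asymptotic curves\<close>

text \<open>In general a product of two continuous functions can vanish without either factor vanishing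
  identically. Here \<open>C\<close> is the derivative of \<open>s\<close>, and at zeros of \<open>C\<close> the vanishing of \<open>E\<close> depends only on
  the value of \<open>s\<close>. If \<open>E t0 \<noteq> 0\<close>, the set of zeros of \<open>C\<close> with \<open>s t = s t0\<close> is closed, and it is open: near
  each of its points \<open>E\<close> is nonzero, so \<open>C\<close> vanishes and \<open>s\<close> is constant. By connectedness it is all
  of \<open>J\<close>.\<close>
lemma zero_product_dichotomy:
  fixes s C E :: "real \<Rightarrow> real"
  assumes J: "open J" "connected J"
    and s: "\<And>t. t \<in> J \<Longrightarrow> (s has_real_derivative C t) (at t)"
    and C: "continuous_on J C" and E: "continuous_on J E"
    and prod: "\<And>t. t \<in> J \<Longrightarrow> C t * E t = 0"
    and transfer: "\<And>t t'. \<lbrakk>t \<in> J; t' \<in> J; s t = s t'; C t = 0; C t' = 0; E t = 0\<rbrakk> \<Longrightarrow> E t' = 0"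
  shows "(\<exists>s0. \<forall>t\<in>J. s t = s0) \<or> (\<forall>t\<in>J. E t = 0)"
proof (rule disjCI)
  assume "\<not> (\<forall>t\<in>J. E t = 0)"
  then obtain t0 where t0: "t0 \<in> J" "E t0 \<noteq> 0" by blast
  define K where "K = {t \<in> J. s t = s t0 \<and> C t = 0}"
  have K_E: "E t \<noteq> 0" if "t \<in> K" for t
    using that t0 transfer[of t t0] prod[of t0] by (auto simp: K_def)
  have s_cont: "continuous_on J s"
    using s by (meson DERIV_isCont continuous_at_imp_continuous_on)
  have "closedin (top_of_set J) (J \<inter> (\<lambda>t. (s t, C t)) -` {(s t0, 0)})"
    by (intro continuous_closedin_preimage continuous_intros s_cont C)
  moreover have "J \<inter> (\<lambda>t. (s t, C t)) -` {(s t0, 0)} = K"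
    by (auto simp: K_def)
  ultimately have "closedin (top_of_set J) K" by simp
  moreover have "openin (top_of_set J) K"
  proof -
    have "open K"
      unfolding open_contains_ball
    proof
      fix t assume t: "t \<in> K"
      have "open (J \<inter> E -` (- {0}))"
        by (rule continuous_open_preimage[OF E J(1)]) auto
      moreover have "t \<in> J \<inter> E -` (- {0})"
        using t K_E by (auto simp: K_def)
      ultimately obtain e where e: "e > 0" "ball t e \<subseteq> J \<inter> E -` (- {0})"
        by (meson open_contains_ball)
      have C0: "C x = 0" if "x \<in> ball t e" for x
        using subsetD[OF e(2) that] prod[of x] by auto
      have "\<exists>c. \<forall>x\<in>ball t e. s x = c"
      proof (rule has_field_derivative_zero_constant)
        fix x assume x: "x \<in> ball t e"
        then have "(s has_real_derivative C x) (at x)"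
          using e(2) by (intro s) auto
        then show "(s has_real_derivative 0) (at x within ball t e)"
          by (simp add: C0[OF x] has_field_derivative_at_within)
      qed simp
      then have "s x = s t" if "x \<in> ball t e" for x
        using that e(1) by (metis centre_in_ball)
      then have "ball t e \<subseteq> K"
        using e(2) C0 t by (auto simp: K_def)
      then show "\<exists>e>0. ball t e \<subseteq> K" using e(1) by blast
    qed
    then show ?thesis by (auto simp: K_def intro: open_subset)
  qed
  ultimately have "K = {} \<or> K = J"
    using J(2) connected_clopen by blast
  moreover have "t0 \<in> K" using t0 prod[of t0] by (auto simp: K_def)
  ultimately have "\<forall>t\<in>J. s t = s t0" by (auto simp: K_def)
  then show "\<exists>s0. \<forall>t\<in>J. s t = s0" by blast
qed

theorem theorem3p16:
  fixes \<alpha> \<beta> :: "real \<Rightarrow> real ^ 3" and \<theta> s u C D :: "real \<Rightarrow> real" and I J :: "real set"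
  assumes "open_interval I" and "frenet_curve \<alpha> I" and "smooth_on \<theta> I"
    and "open_interval J" and "smooth_on s J" and "smooth_on u J"
    and "\<And>t. t \<in> J \<Longrightarrow> s t \<in> I"
    and "\<And>t. t \<in> J \<Longrightarrow> regular_point (OT_surface \<alpha> \<theta>) (s t, u t)"
    and beta: "\<beta> = OT_surface \<alpha> \<theta> \<circ> (\<lambda>t. (s t, u t))"
    and "unit_speed_on \<beta> J"
    and C: "\<And>t. t \<in> J \<Longrightarrow> C t = deriv s t"
    and D: "\<And>t. t \<in> J \<Longrightarrow> D t = deriv u t"
  shows "asymptotic_curve (OT_surface \<alpha> \<theta>) (\<lambda>t. (s t, u t)) J \<longleftrightarrow>
    is_ruling (\<lambda>t. (s t, u t)) J \<or>
    (\<forall>t\<in>J.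
       (C t * cos (\<theta> (s t)) + D t)
         * (OT_A1 \<alpha> \<theta> (s t) (u t) * cos (\<theta> (s t)) + OT_A2 \<alpha> \<theta> (s t) (u t))
       + (C t * OT_A1 \<alpha> \<theta> (s t) (u t) + D t * OT_B1 \<alpha> \<theta> (s t) (u t))
         * ((OT_f \<alpha> \<theta> (s t) (u t))\<^sup>2 + (OT_g \<alpha> \<theta> (s t) (u t))\<^sup>2) = 0)"
proof -
  interpret OT_ruled \<alpha> \<theta> I
    by unfold_locales (use assms in \<open>simp_all add: open_interval_def\<close>)
  have J: "open J" "connected J"
    using assms(4) by (simp_all add: open_interval_def is_interval_connected)
  have Q: "OT_Q \<alpha> \<theta> (s t) (u t) > 0" if "t \<in> J" for t
    using assms(7,8)[OF that] regular_point_iff by blast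
  have vC: "C t = vderiv s t" and vD: "D t = vderiv u t" if "t \<in> J" for t
    using that by (simp_all add: C D field_derivative_eq_vector_derivative)
  have s': "(s has_real_derivative C t) (at t)" and u': "(u has_real_derivative D t) (at t)"
    if "t \<in> J" for t
    using smooth_on_has_vector_derivative[OF assms(5) that]
      smooth_on_has_vector_derivative[OF assms(6) that]
    by (simp_all add: vC[OF that] vD[OF that] has_real_derivative_iff_has_vector_derivative)
  let ?Xs = "\<lambda>t. cos (\<theta> (s t)) *\<^sub>R q (s t) + f (s t) (u t) *\<^sub>R r (s t) + g (s t) (u t) *\<^sub>R b (s t)"
  have velocity: "vderiv (OT_surface \<alpha> \<theta> \<circ> (\<lambda>t. (s t, u t))) t = C t *\<^sub>R ?Xs t + D t *\<^sub>R q (s t)"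
    if "t \<in> J" for t
  proof (rule vector_derivative_at)
    have "((\<lambda>t. (s t, u t)) has_derivative (\<lambda>h. (h *\<^sub>R C t, h *\<^sub>R D t))) (at t)"
      using s'[OF that] u'[OF that]
      by (intro has_derivative_Pair)
        (simp_all add: has_field_derivative_def mult.commute[of _ "C t"] mult.commute[of _ "D t"])
    from diff_chain_at[OF this surface_derivative[OF assms(7)[OF that]]]
    show "(OT_surface \<alpha> \<theta> \<circ> (\<lambda>t. (s t, u t)) has_vector_derivative
        C t *\<^sub>R ?Xs t + D t *\<^sub>R q (s t)) (at t)"
      by (simp add: has_vector_derivative_def o_def scaleR_add_right mult.assoc)
  qed
  define P where "P t = C t * second_ss (s t) (u t) + 2 * D t * (\<mu> (s t) * sin (\<theta> (s t)))" for t
  have eqn: "(C t * cos (\<theta> (s t)) + D t)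
         * (OT_A1 \<alpha> \<theta> (s t) (u t) * cos (\<theta> (s t)) + OT_A2 \<alpha> \<theta> (s t) (u t))
       + (C t * OT_A1 \<alpha> \<theta> (s t) (u t) + D t * OT_B1 \<alpha> \<theta> (s t) (u t))
         * ((f (s t) (u t))\<^sup>2 + (g (s t) (u t))\<^sup>2) = 0 \<longleftrightarrow> P t = 0" if "t \<in> J" for t
    using Q[OF that] unfolding equation_eq[OF Q[OF that]] by (simp add: P_def)
  have asym: "asymptotic_curve (OT_surface \<alpha> \<theta>) (\<lambda>t. (s t, u t)) J \<longleftrightarrow> (\<forall>t\<in>J. C t * P t = 0)"
    unfolding asymptotic_curve_def
  proof (rule ball_cong[OF refl])
    fix t assume t: "t \<in> J"
    show "normal_curvature (OT_surface \<alpha> \<theta>) (s t, u t)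
        (vderiv (OT_surface \<alpha> \<theta> \<circ> (\<lambda>t. (s t, u t))) t) = 0 \<longleftrightarrow> C t * P t = 0"
      using Q[OF t]
      by (simp add: velocity[OF t] normal_curvature_OT[OF assms(7,8)[OF t]] P_def)
  qed
  \<comment> \<open>A unit vector cannot have both coordinates zero. So where \<open>C\<close> vanishes, \<open>P\<close> vanishes iff
    \<open>\<mu> sin \<theta>\<close> does, and the latter is a function of \<open>s\<close> alone.\<close>
  have D_nz: "D t \<noteq> 0" if "t \<in> J" "C t = 0" for t
    using assms(10) that velocity[OF that(1)] by (auto simp: unit_speed_on_def beta)
  have cont: "continuous_on J C" "continuous_on J D"
    using vC vD assms(5,6)
    by (simp_all cong: continuous_on_cong add: smooth_on_imp_continuous_on smooth_on_vderiv)
  have sc: "continuous_on J s" "continuous_on J u" "s ` J \<subseteq> I"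
    using assms(5-7) by (auto intro: smooth_on_imp_continuous_on)
  have "continuous_on J (\<lambda>t. \<mu> (s t))" "continuous_on J (\<lambda>t. \<theta> (s t))"
    by (rule continuous_on_compose2[OF _ sc(1,3)],
        intro C1_differentiable_imp_continuous_on eta_mu_C1 smooth_on_imp_C1 th)+
  then have P_cont: "continuous_on J P"
    unfolding P_def[abs_def] by (intro continuous_intros cont continuous_on_second_ss sc)
  have "asymptotic_curve (OT_surface \<alpha> \<theta>) (\<lambda>t. (s t, u t)) J \<longleftrightarrow>
      is_ruling (\<lambda>t. (s t, u t)) J \<or> (\<forall>t\<in>J. P t = 0)"
    unfolding asym
  proof
    assume "\<forall>t\<in>J. C t * P t = 0"
    then have "(\<exists>s0. \<forall>t\<in>J. s t = s0) \<or> (\<forall>t\<in>J. P t = 0)"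
      by (intro zero_product_dichotomy[OF J s' cont(1) P_cont])
        (use D_nz in \<open>auto simp: P_def\<close>)
    then show "is_ruling (\<lambda>t. (s t, u t)) J \<or> (\<forall>t\<in>J. P t = 0)"
      by (simp add: is_ruling_def)
  next
    assume "is_ruling (\<lambda>t. (s t, u t)) J \<or> (\<forall>t\<in>J. P t = 0)"
    moreover have "C t = 0" if "\<forall>t\<in>J. s t = s0" "t \<in> J" for t s0
    proof (rule DERIV_unique[OF s'[OF that(2)]])
      show "(s has_real_derivative 0) (at t)"
        using has_field_derivative_transform_within_open[OF DERIV_const J(1) that(2), of s0 s] that(1)
        by simp
    qed
    ultimately show "\<forall>t\<in>J. C t * P t = 0"
      by (auto simp: is_ruling_def)
  qed
  then show ?thesis
    using eqn by simp
qed

end
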